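(* Let $(G,Q)$ be an instance of the QCCP. All vectors $d_k$, $k\ge 0$, computed during the RGL (reformulated Gilmore-Lawler type bound) procedure satisfy the constant value property, i.e. $x^Td_k=\bar x^Td_k$ for all cycle covers $x,\bar x\in X$.
   Context: An instance of the QCCP (quadratic cycle cover problem, minimize $x^TQx$ over $x\in X$) is a pair $(G,Q)$ with $G=(N,A)$ a directed graph, $A\subseteq N\times N$, $N=\{1,\dots,n\}$, $|A|=m$, and $Q\in\mathbb{R}^{m\times m}$ indexed by arcs, with $Q_{ef}=0$ if the starting node of $f$ is not the ending node of $e$ (except that linear arc costs may be placed on the diagonal). For an arc $e$, $e^+$ is its starting node and $e^-$ its ending node. For $i\in N$, $\delta^+(i)$ and $\delta^-(i)$ are the sets of arcs leaving and entering $i$. The set of cycle covers is $$X=\Big\{x\in\{0,1\}^m : \sum_{e\in\delta^+(i)}x_e=\sum_{e\in\delta^-(i)}x_e=1\ \ \forall i\in N\Big\}.$$ Let $U,V\in\mathbb{R}^{n\times m}$ with $U_{ie}=1$ if $i=e^+$ and $0$ otherwise, $V_{ie}=1$ if $i=e^-$ and $0$ otherwise; $\mathbf{1}_{2n}$ is the all-ones vector. For $R\in\mathbb{R}^{m\times m}$ and $\eta\in[0,1]$ write $R^\eta:=\eta R+(1-\eta)R^T$, and let $\tau_{GL}(R)$ be the set of $\hat p\in\mathbb{R}^m$ for which there are $t\in\mathbb{R}^m$, $B,C\in\mathbb{R}^{m\times n}$ with $B_{e,f^+}+C_{e,f^-}\le R_{ef}$ for all $e\ne f$ in $A$, $\ B_{e,e^+}+C_{e,e^-}+t_e\le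 R_{ee}$ for all $e\in A$, and $\hat p_e=t_e+\sum_{i=1}^nB_{e,i}+\sum_{i=1}^nC_{e,i}$ for all $e\in A$. RGL procedure: set $Q_0=Q$, $d_0=\mathbf 0\in\mathbb{R}^m$, $k=1$, $r_0=\infty$. While $r_{k-1}>0$: (1) compute an optimal solution ($y$, $p_k$, $\eta$, together with the associated $B,C,t$) of $$r_k:=\max_{y\in\mathbb{R}^{2n},\ p_k\in\mathbb{R}^m,\ \eta\in[0,1]}\{\mathbf{1}_{2n}^Ty : [U^T,V^T]y=p_k,\ p_k\in\tau_{GL}(Q_{k-1}^\eta)\};$$ (2) let $\hat Q_{k-1}$ be the matrix with $(\hat Q_{k-1})_{ef}=B_{e,f^+}+C_{e,f^-}$ for $e\neq f$ and $(\hat Q_{k-1})_{ee}=B_{e,e^+}+C_{e,e^-}+t_e$; (3) set $Q_k=\eta Q_{k-1}+(1-\eta)Q_{k-1}^T-\hat Q_{k-1}$, $d_k=d_{k-1}+p_k$, and $k\leftarrow k+1$. *)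

theory Defs
  imports Complex_Main "HOL-Library.Extended_Real"
begin

text \<open>
  Nodes are the numbers \<open>1, \<dots>, n\<close>, and an arc is the pair of its starting and its ending node.
  A vector or matrix indexed by the arc set \<open>A\<close> (by the nodes, by \<open>1, \<dots>, 2n\<close>) is a total function
  of which only the values on the index set are ever used.
\<close>

type_synonym arc = "nat \<times> nat"
type_synonym arc_vec = "arc \<Rightarrow> real"
type_synonym arc_mat = "arc \<Rightarrow> arc \<Rightarrow> real"
type_synonym arc_node_mat = "arc \<Rightarrow> nat \<Rightarrow> real"

text \<open>The off-diagonal costs are those of pairs of successive arcs; the diagonal may carry
  linear arc costs.\<close>

definition qccp_instance :: "nat \<Rightarrow> arc set \<Rightarrow> arc_mat \<Rightarrow> bool" where
  "qccp_instance n A Q \<longleftrightarrow>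
     A \<subseteq> {1..n} \<times> {1..n} \<and>
     (\<forall>e\<in>A. \<forall>f\<in>A. e \<noteq> f \<longrightarrow> fst f \<noteq> snd e \<longrightarrow> Q e f = 0)"

definition arcs_leaving :: "arc set \<Rightarrow> nat \<Rightarrow> arc set" where
  "arcs_leaving A i = {e \<in> A. fst e = i}"

definition arcs_entering :: "arc set \<Rightarrow> nat \<Rightarrow> arc set" where
  "arcs_entering A i = {e \<in> A. snd e = i}"

definition cycle_covers :: "nat \<Rightarrow> arc set \<Rightarrow> arc_vec set" where
  "cycle_covers n A =
     {x. (\<forall>e\<in>A. x e \<in> {0, 1}) \<and>
         (\<forall>i\<in>{1..n}. (\<Sum>e\<in>arcs_leaving A i. x e) = 1 \<and> (\<Sum>e\<in>arcs_entering A i. x e) = 1)}"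

definition constant_value_property :: "nat \<Rightarrow> arc set \<Rightarrow> arc_vec \<Rightarrow> bool" where
  "constant_value_property n A d \<longleftrightarrow>
     (\<forall>x\<in>cycle_covers n A. \<forall>x'\<in>cycle_covers n A.
        (\<Sum>e\<in>A. x e * d e) = (\<Sum>e\<in>A. x' e * d e))"

definition U_mat :: "nat \<Rightarrow> arc \<Rightarrow> real" where
  "U_mat i e = (if i = fst e then 1 else 0)"

definition V_mat :: "nat \<Rightarrow> arc \<Rightarrow> real" where
  "V_mat i e = (if i = snd e then 1 else 0)"

definition eta_mix :: "real \<Rightarrow> arc_mat \<Rightarrow> arc_mat" where
  "eta_mix \<eta> R = (\<lambda>e f. \<eta> * R e f + (1 - \<eta>) * R f e)"

definition GL_certificate ::
  "nat \<Rightarrow> arc set \<Rightarrow> arc_mat \<Rightarrow> arc_vec \<Rightarrow> arc_node_mat \<Rightarrow> arc_node_mat \<Rightarrow> arc_vec \<Rightarrow> bool" where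
  "GL_certificate n A R p B C t \<longleftrightarrow>
     (\<forall>e\<in>A. \<forall>f\<in>A. e \<noteq> f \<longrightarrow> B e (fst f) + C e (snd f) \<le> R e f) \<and>
     (\<forall>e\<in>A. B e (fst e) + C e (snd e) + t e \<le> R e e) \<and>
     (\<forall>e\<in>A. p e = t e + (\<Sum>i=1..n. B e i) + (\<Sum>i=1..n. C e i))"

definition tau_GL :: "nat \<Rightarrow> arc set \<Rightarrow> arc_mat \<Rightarrow> arc_vec set" where
  "tau_GL n A R = {p. \<exists>t B C. GL_certificate n A R p B C t}"

definition RGL_objective :: "nat \<Rightarrow> (nat \<Rightarrow> real) \<Rightarrow> real" where
  "RGL_objective n y = (\<Sum>i=1..2*n. y i)"

text \<open>In the equation \<open>[U\<^sup>T, V\<^sup>T] y = p\<close>, the second block of \<open>y\<close> has the indices \<open>n+1, \<dots>, 2n\<close>.\<close>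

definition RGL_feasible ::
  "nat \<Rightarrow> arc set \<Rightarrow> arc_mat \<Rightarrow> (nat \<Rightarrow> real) \<Rightarrow> arc_vec \<Rightarrow> real \<Rightarrow> bool" where
  "RGL_feasible n A R y p \<eta> \<longleftrightarrow>
     \<eta> \<in> {0..1} \<and>
     (\<forall>e\<in>A. (\<Sum>i=1..n. U_mat i e * y i) + (\<Sum>i=1..n. V_mat i e * y (n + i)) = p e) \<and>
     p \<in> tau_GL n A (eta_mix \<eta> R)"

definition RGL_optimal ::
  "nat \<Rightarrow> arc set \<Rightarrow> arc_mat \<Rightarrow> (nat \<Rightarrow> real) \<Rightarrow> arc_vec \<Rightarrow> real \<Rightarrow> bool" where
  "RGL_optimal n A R y p \<eta> \<longleftrightarrow>
     RGL_feasible n A R y p \<eta> \<and>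
     (\<forall>y' p' \<eta>'. RGL_feasible n A R y' p' \<eta>' \<longrightarrow> RGL_objective n y' \<le> RGL_objective n y)"

definition Q_hat :: "arc_node_mat \<Rightarrow> arc_node_mat \<Rightarrow> arc_vec \<Rightarrow> arc_mat" where
  "Q_hat B C t = (\<lambda>e f. if e \<noteq> f then B e (fst f) + C e (snd f)
                        else B e (fst e) + C e (snd e) + t e)"

text \<open>
  \<open>RGL_reaches n A Q k Qk dk rk\<close> means that some run of the procedure on \<open>Q\<close> computes \<open>Qk\<close>, \<open>dk\<close>,
  \<open>rk\<close> as its \<open>k\<close>-th iterates. It is a relation since the optimal solution, and the certificate
  \<open>B\<close>, \<open>C\<close>, \<open>t\<close> that goes with it, need not be unique: every choice gives a run.
\<close>

inductive RGL_reaches ::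
  "nat \<Rightarrow> arc set \<Rightarrow> arc_mat \<Rightarrow> nat \<Rightarrow> arc_mat \<Rightarrow> arc_vec \<Rightarrow> ereal \<Rightarrow> bool"
  for n :: nat and A :: "arc set" and Q :: arc_mat where
  init: "RGL_reaches n A Q 0 Q (\<lambda>e. 0) \<infinity>"
| step: "RGL_reaches n A Q (Suc k)
           (\<lambda>e f. eta_mix \<eta> Qk e f - Q_hat B C t e f)
           (\<lambda>e. dk e + p e)
           (ereal (RGL_objective n y))"
  if "RGL_reaches n A Q k Qk dk rk"
    and "rk > 0"
    and "RGL_optimal n A Qk y p \<eta>"
    and "GL_certificate n A (eta_mix \<eta> Qk) p B C t"

end

theory Submission
  imports Defs
begin

text \<open>
  The constraint \<open>[U\<^sup>T, V\<^sup>T] y = p\<close> says that \<open>p\<close> is a sum of node potentials: an arc \<open>e\<close> costs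
  \<open>y\<close> at its starting node plus a second potential at its ending node. A cycle cover leaves and
  enters every node exactly once, so it collects each potential exactly once at each node, and its
  total cost is \<open>\<one>\<^sup>T y\<close>, whichever cover it is (\<open>constant_value_node_potentials\<close>).
  Since \<open>d\<^sub>k\<close> is the sum of the vectors \<open>p\<^sub>1, \<dots>, p\<^sub>k\<close> and the constant value property is closed
  under addition, it is inherited by every \<open>d\<^sub>k\<close>.
\<close>

text \<open>
  Grouping the arcs by their starting node makes \<open>a i\<close> the common factor of the group of \<open>i\<close>, and
  the cover has total weight 1 on that group.
\<close>

lemma cycle_cover_sum_start:
  fixes a :: "nat \<Rightarrow> real"
  assumes A: "A \<subseteq> {1..n} \<times> {1..n}" and x: "x \<in> cycle_covers n A"
  shows "(\<Sum>e\<in>A. x e * a (fst e)) = (\<Sum>i=1..n. a i)"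
proof -
  have "finite A" using A by (rule finite_subset) simp
  then have "(\<Sum>e\<in>A. x e * a (fst e)) = (\<Sum>i=1..n. \<Sum>e\<in>arcs_leaving A i. x e * a (fst e))"
    unfolding arcs_leaving_def using A by (intro sum.group[symmetric]) auto
  also have "\<dots> = (\<Sum>i=1..n. (\<Sum>e\<in>arcs_leaving A i. x e) * a i)"
    by (simp add: arcs_leaving_def sum_distrib_right)
  also have "\<dots> = (\<Sum>i=1..n. a i)"
    using x by (simp add: cycle_covers_def)
  finally show ?thesis .
qed

lemma cycle_cover_sum_end:
  fixes b :: "nat \<Rightarrow> real"
  assumes A: "A \<subseteq> {1..n} \<times> {1..n}" and x: "x \<in> cycle_covers n A"
  shows "(\<Sum>e\<in>A. x e * b (snd e)) = (\<Sum>i=1..n. b i)"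
proof -
  have "finite A" using A by (rule finite_subset) simp
  then have "(\<Sum>e\<in>A. x e * b (snd e)) = (\<Sum>i=1..n. \<Sum>e\<in>arcs_entering A i. x e * b (snd e))"
    unfolding arcs_entering_def using A by (intro sum.group[symmetric]) auto
  also have "\<dots> = (\<Sum>i=1..n. (\<Sum>e\<in>arcs_entering A i. x e) * b i)"
    by (simp add: arcs_entering_def sum_distrib_right)
  also have "\<dots> = (\<Sum>i=1..n. b i)"
    using x by (simp add: cycle_covers_def)
  finally show ?thesis .
qed

text \<open>
  Both potentials contribute their sum over all nodes, a value that does not mention the cover.
\<close>

lemma constant_value_node_potentials:
  assumes A: "A \<subseteq> {1..n} \<times> {1..n}"
    and p: "\<And>e. e \<in> A \<Longrightarrow> p e = a (fst e) + b (snd e)"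
  shows "constant_value_property n A p"
proof -
  have "(\<Sum>e\<in>A. x e * p e) = (\<Sum>i=1..n. a i) + (\<Sum>i=1..n. b i)" if x: "x \<in> cycle_covers n A" for x
  proof -
    have "(\<Sum>e\<in>A. x e * p e) = (\<Sum>e\<in>A. x e * a (fst e)) + (\<Sum>e\<in>A. x e * b (snd e))"
      by (simp add: p distrib_left sum.distrib)
    then show ?thesis
      using cycle_cover_sum_start[OF A x] cycle_cover_sum_end[OF A x] by simp
  qed
  then show ?thesis by (simp add: constant_value_property_def)
qed

lemma constant_value_add:
  assumes "constant_value_property n A d" and "constant_value_property n A p"
  shows "constant_value_property n A (\<lambda>e. d e + p e)"
  unfolding constant_value_property_def
proof (intro ballI)
  fix x x' assume "x \<in> cycle_covers n A" "x' \<in> cycle_covers n A"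
  then have "(\<Sum>e\<in>A. x e * d e) = (\<Sum>e\<in>A. x' e * d e)" "(\<Sum>e\<in>A. x e * p e) = (\<Sum>e\<in>A. x' e * p e)"
    using assms unfolding constant_value_property_def by blast+
  then show "(\<Sum>e\<in>A. x e * (d e + p e)) = (\<Sum>e\<in>A. x' e * (d e + p e))"
    by (simp add: distrib_left sum.distrib)
qed

lemma constant_value_RGL_feasible:
  assumes A: "A \<subseteq> {1..n} \<times> {1..n}" and "RGL_feasible n A R y p \<eta>"
  shows "constant_value_property n A p"
proof (rule constant_value_node_potentials[OF A])
  fix e assume e: "e \<in> A"
  then have ends: "fst e \<in> {1..n}" "snd e \<in> {1..n}" using A by auto
  have "p e = (\<Sum>i=1..n. U_mat i e * y i) + (\<Sum>i=1..n. V_mat i e * y (n + i))"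
    using assms(2) e unfolding RGL_feasible_def by simp
  \<comment> \<open>Each column of \<open>U\<close> and of \<open>V\<close> is a unit vector, because both ends of an arc are nodes.\<close>
  also have "(\<Sum>i=1..n. U_mat i e * y i) = (\<Sum>i=1..n. if i = fst e then y i else 0)"
    by (intro sum.cong) (auto simp: U_mat_def)
  also have "\<dots> = y (fst e)" using ends by simp
  also have "(\<Sum>i=1..n. V_mat i e * y (n + i)) = (\<Sum>i=1..n. if i = snd e then y (n + i) else 0)"
    by (intro sum.cong) (auto simp: V_mat_def)
  also have "\<dots> = y (n + snd e)" using ends by simp
  finally show "p e = y (fst e) + y (n + snd e)" .
qed

theorem theorem5:
  fixes n k :: nat and A :: "arc set" and Q Qk :: arc_mat and dk :: arc_vec and rk :: ereal
  assumes "qccp_instance n A Q"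
    and "RGL_reaches n A Q k Qk dk rk"
  shows "constant_value_property n A dk"
  using assms(2)
proof induction
  case init
  show ?case by (simp add: constant_value_property_def)
next
  case (step k Qk dk rk y p \<eta> B C t)
  have "A \<subseteq> {1..n} \<times> {1..n}" using assms(1) by (simp add: qccp_instance_def)
  moreover have "RGL_feasible n A Qk y p \<eta>" using step.hyps by (simp add: RGL_optimal_def)
  ultimately have "constant_value_property n A p" by (rule constant_value_RGL_feasible)
  with step.IH show ?case by (rule constant_value_add)
qed

end
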